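(* Let $\Phi:\mathbb{R}^n\rightrightarrows\mathbb{R}^m$ be a polyhedral set-valued mapping. Then for all $b\in\operatorname{Im}(\Phi)$ and $u\in\operatorname{dom}(\Phi)$ $$\operatorname{dist}(u,\Phi^{-1}(b))\le\mathcal{H}(\Phi)\cdot\operatorname{dist}(b,\Phi(u)).$$ Furthermore, this bound is tight: if $\mathcal{H}(\Phi)>0$ then there exist $b\in\operatorname{Im}(\Phi)$ and $u\in\operatorname{dom}(\Phi)$ such that $$\operatorname{dist}(u,\Phi^{-1}(b))=\mathcal{H}(\Phi)\cdot\operatorname{dist}(b,\Phi(u))>0.$$
   Context: $\mathbb{R}^n$ and $\mathbb{R}^m$ are each endowed with an arbitrary norm (not necessarily Euclidean), both denoted $\|\cdot\|$. For a nonempty closed set $S$, $\operatorname{dist}(u,S)=\min_{x\in S}\|u-x\|$. A set-valued mapping $\Phi:\mathbb{R}^n\rightrightarrows\mathbb{R}^m$ assigns a set $\Phi(x)\subseteq\mathbb{R}^m$ to each $x\in\mathbb{R}^n$. Its graph is $\operatorname{graph}(\Phi)=\{(x,y):y\in\Phi(x)\}$; $\Phi$ is polyhedral if $\operatorname{graph}(\Phi)$ is a (nonempty) polyhedron. $\operatorname{dom}(\Phi)=\{x:\Phi(x)\ne\emptyset\}$, $\operatorname{Im}(\Phi)=\bigcup_x\Phi(x)$, and $\Phi^{-1}(y)=\{x:y\in\Phi(x)\}$. For a polyhedron $Q$ and $u\in Q$, $T_Q(u)=\{d:u+td\in Q\text{ for some }t>0\}$ is the tangent cone, and $\mathcal{T}(Q)=\{T_Q(u):u\in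 Q\}$ (a finite collection). For a polyhedral cone $T\subseteq\mathbb{R}^n\times\mathbb{R}^m$, $\Phi_T:\mathbb{R}^n\rightrightarrows\mathbb{R}^m$ is defined by $y\in\Phi_T(x)\Leftrightarrow(x,y)\in T$, and $$\|\Phi_T^{-1}\|:=\max_{y\in\operatorname{Im}(\Phi_T),\ \|y\|\le1}\ \min_{x\in\Phi_T^{-1}(y)}\|x\|.$$ A mapping is relatively surjective if its image is a linear subspace. Let $$\mathfrak{S}(\operatorname{graph}(\Phi)):=\{T\in\mathcal{T}(\operatorname{graph}(\Phi)):\Phi_T\text{ is relatively surjective}\},\qquad \mathcal{H}(\Phi):=\max_{T\in\mathfrak{S}(\operatorname{graph}(\Phi))}\|\Phi_T^{-1}\|.$$ *)

theory Defs
  imports "HOL-Analysis.Analysis"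
begin

text \<open>The library's \<^const>\<open>norm\<close> on \<open>real ^ 'n\<close> is the Euclidean one. Arbitrary norms are
  therefore passed as functions \<open>N\<close> satisfying the norm axioms.\<close>

definition is_norm :: "('a::real_vector \<Rightarrow> real) \<Rightarrow> bool" where
  "is_norm N \<longleftrightarrow>
     (\<forall>x. 0 \<le> N x) \<and>
     (\<forall>x. N x = 0 \<longleftrightarrow> x = 0) \<and>
     (\<forall>c x. N (c *\<^sub>R x) = \<bar>c\<bar> * N x) \<and>
     (\<forall>x y. N (x + y) \<le> N x + N y)"

text \<open>Distance with respect to \<open>N\<close>. As for the library's \<^const>\<open>infdist\<close>, the minimum is written
  as an infimum; in finite dimension it is attained for nonempty closed \<open>S\<close>.\<close>

definition norm_dist :: "('a::real_vector \<Rightarrow> real) \<Rightarrow> 'a \<Rightarrow> 'a set \<Rightarrow> real" where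
  "norm_dist N u S = (INF x\<in>S. N (u - x))"

definition sv_graph :: "('a \<Rightarrow> 'b set) \<Rightarrow> ('a \<times> 'b) set" where
  "sv_graph \<Phi> = {(x, y). y \<in> \<Phi> x}"

definition sv_dom :: "('a \<Rightarrow> 'b set) \<Rightarrow> 'a set" where
  "sv_dom \<Phi> = {x. \<Phi> x \<noteq> {}}"

definition sv_Im :: "('a \<Rightarrow> 'b set) \<Rightarrow> 'b set" where
  "sv_Im \<Phi> = (\<Union>x. \<Phi> x)"

definition sv_inv :: "('a \<Rightarrow> 'b set) \<Rightarrow> 'b \<Rightarrow> 'a set" where
  "sv_inv \<Phi> y = {x. y \<in> \<Phi> x}"

definition polyhedral_map :: "('a::euclidean_space \<Rightarrow> 'b::euclidean_space set) \<Rightarrow> bool" where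
  "polyhedral_map \<Phi> \<longleftrightarrow> polyhedron (sv_graph \<Phi>) \<and> sv_graph \<Phi> \<noteq> {}"

definition tangent_cone :: "'a::real_vector set \<Rightarrow> 'a \<Rightarrow> 'a set" where
  "tangent_cone Q u = {d. \<exists>t>0. u + t *\<^sub>R d \<in> Q}"

definition tangent_cones :: "'a::real_vector set \<Rightarrow> 'a set set" where
  "tangent_cones Q = {tangent_cone Q u | u. u \<in> Q}"

definition cone_map :: "('a \<times> 'b) set \<Rightarrow> 'a \<Rightarrow> 'b set" where
  "cone_map T x = {y. (x, y) \<in> T}"

definition relatively_surjective :: "('a \<Rightarrow> 'b::real_vector set) \<Rightarrow> bool" where
  "relatively_surjective \<Phi> \<longleftrightarrow> subspace (sv_Im \<Phi>)"

text \<open>\<open>inv_norm NX NY \<Phi>\<close> is the norm of the inverse mapping. It is used only for \<open>\<Phi> = cone_map T\<close>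
  with \<open>T\<close> a polyhedral cone; there the infima and the supremum are finite and attained.\<close>

definition inv_norm ::
    "('a \<Rightarrow> real) \<Rightarrow> ('b \<Rightarrow> real) \<Rightarrow> ('a \<Rightarrow> 'b set) \<Rightarrow> real" where
  "inv_norm NX NY \<Phi> = (SUP y\<in>{y \<in> sv_Im \<Phi>. NY y \<le> 1}. INF x\<in>sv_inv \<Phi> y. NX x)"

definition surj_cones :: "('a::real_vector \<times> 'b::real_vector) set \<Rightarrow> ('a \<times> 'b) set set" where
  "surj_cones G = {T \<in> tangent_cones G. relatively_surjective (cone_map T)}"

text \<open>A polyhedron has finitely many tangent cones, and at a relative interior point of the graph
  the tangent cone is a linear subspace, so for polyhedral \<open>\<Phi>\<close> the maximum below ranges over a
  finite nonempty set.\<close>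

definition hoffman_const ::
    "('a::real_vector \<Rightarrow> real) \<Rightarrow> ('b::real_vector \<Rightarrow> real) \<Rightarrow> ('a \<Rightarrow> 'b set) \<Rightarrow> real" where
  "hoffman_const NX NY \<Phi> = (MAX T\<in>surj_cones (sv_graph \<Phi>). inv_norm NX NY (cone_map T))"

end

theory Submission
  imports Defs
begin

text \<open>Let \<open>x\<close> be a nearest point to \<open>u\<close> in \<open>\<Phi>\<^sup>-\<^sup>1(b)\<close> and \<open>G\<close> the graph. Separation from the ball around \<open>u\<close>
  gives \<open>p\<close> with dual norm at most 1 and \<open>p \<bullet> (x - u) = \<parallel>x - u\<parallel>\<close>, and Farkas' lemma completes \<open>- p\<close> to
  an element \<open>(- p, q)\<close> of the polar of the tangent cone of \<open>G\<close> at \<open>(x, b)\<close>. Changing only \<open>q\<close>, the cone can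
  be enlarged to a relatively surjective tangent cone \<open>T\<close>. For \<open>v \<in> \<Phi>(u)\<close> the vector \<open>(u - x, v - b)\<close> lies in
  \<open>T\<close>, so \<open>\<parallel>x - u\<parallel> \<le> q \<bullet> (b - v)\<close>; as the image of \<open>T\<close> is a subspace, it also contains \<open>b - v\<close>, and
  \<open>(w, b - v) \<in> T\<close> yields \<open>q \<bullet> (b - v) \<le> p \<bullet> w \<le> \<parallel>w\<parallel>\<close>. For tightness, take the maximizing \<open>T\<close>, the tangent cone
  at \<open>(u, v)\<close>, a \<open>y\<close> attaining its inverse norm, and \<open>b = v + t y\<close> with small \<open>t > 0\<close>.\<close>

subsection \<open>Tangent cones of polyhedra\<close>

lemma convex_cone_tangent_cone:
  assumes "convex Q" "u \<in> Q"
  shows "convex_cone (tangent_cone Q u)"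
  unfolding convex_cone_iff
proof (intro conjI ballI allI impI)
  show "0 \<in> tangent_cone Q u"
    using assms(2) by (auto simp: tangent_cone_def intro!: exI[of _ 1])
next
  fix d e assume "d \<in> tangent_cone Q u" "e \<in> tangent_cone Q u"
  then obtain s t where s: "s > 0" "u + s *\<^sub>R d \<in> Q" and t: "t > 0" "u + t *\<^sub>R e \<in> Q"
    by (auto simp: tangent_cone_def)
  have sum: "t / (s + t) + s / (s + t) = 1"
    using s t by (simp add: add.commute flip: add_divide_distrib)
  \<comment> \<open>The weights are chosen so that \<open>d\<close> and \<open>e\<close> receive the
    same coefficient \<open>s * t / (s + t)\<close>.\<close>
  have "(t / (s + t)) *\<^sub>R (u + s *\<^sub>R d) + (s / (s + t)) *\<^sub>R (u + t *\<^sub>R e) \<in> Q"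
    using s t by (intro convexD[OF assms(1)] sum) auto
  also have "(t / (s + t)) *\<^sub>R (u + s *\<^sub>R d) + (s / (s + t)) *\<^sub>R (u + t *\<^sub>R e)
      = (t / (s + t) + s / (s + t)) *\<^sub>R u + (s * t / (s + t)) *\<^sub>R (d + e)"
    by (simp add: scaleR_add_right scaleR_add_left mult.commute)
  finally have "u + (s * t / (s + t)) *\<^sub>R (d + e) \<in> Q"
    unfolding sum by simp
  then show "d + e \<in> tangent_cone Q u"
    using s t by (auto simp: tangent_cone_def intro!: exI[of _ "s * t / (s + t)"])
next
  fix d c assume d: "d \<in> tangent_cone Q u" and c: "0 \<le> (c::real)"
  then obtain s where s: "s > 0" "u + s *\<^sub>R d \<in> Q"
    by (auto simp: tangent_cone_def)
  show "c *\<^sub>R d \<in> tangent_cone Q u"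
  proof (cases "c = 0")
    case True
    then show ?thesis using assms(2) by (auto simp: tangent_cone_def intro!: exI[of _ 1])
  next
    case False
    then show ?thesis
      using s c by (auto simp: tangent_cone_def intro!: exI[of _ "s / c"])
  qed
qed

lemma diff_in_tangent_cone: "z \<in> Q \<Longrightarrow> z - u \<in> tangent_cone Q u"
  by (auto simp: tangent_cone_def intro!: exI[of _ 1])

text \<open>Cutting \<open>Q\<close> with a box around \<open>u\<close> leaves a polytope with the
  same feasible directions at \<open>u\<close>. If it is the hull of a finite set \<open>V\<close>,
  the differences \<open>v - u\<close> with \<open>v\<close> in \<open>V\<close> generate the
  cone.\<close>

lemma tangent_cone_finitely_generated:
  fixes Q :: "'a::euclidean_space set"
  assumes "polyhedron Q" "u \<in> Q"
  obtains D where "finite D" "tangent_cone Q u = convex_cone hull D"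
proof -
  obtain a b where ab: "cball u 1 \<subseteq> cbox a b"
    by (metis bounded_subset_cbox_symmetric bounded_cball)
  have "polytope (Q \<inter> cbox a b)"
    by (simp add: assms(1) bounded_Int polytope_eq_bounded_polyhedron polyhedron_Int
        polytope_imp_polyhedron polytope_interval)
  then obtain V where V: "finite V" "Q \<inter> cbox a b = convex hull V"
    by (auto simp: polytope_def)
  define D where "D = (\<lambda>v. v - u) ` V"
  have cQ: "convex Q"
    using assms(1) by (rule polyhedron_imp_convex)
  have "tangent_cone Q u \<subseteq> convex_cone hull D"
  proof
    fix d assume "d \<in> tangent_cone Q u"
    then obtain t where t: "t > 0" "u + t *\<^sub>R d \<in> Q"
      by (auto simp: tangent_cone_def)
    \<comment> \<open>The second bound keeps the shortened step inside the unit ball, and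
      \<open>s \<le> 1\<close> keeps its endpoint on a segment of \<open>Q\<close>. Adding 1 to
      \<open>norm d\<close> covers the case \<open>d = 0\<close>.\<close>
    define s where "s = min 1 (1 / (t * (norm d + 1)))"
    have pos: "t * (norm d + 1) > 0"
      using t by (simp add: add_nonneg_pos)
    then have s: "s > 0" "s \<le> 1" by (auto simp: s_def)
    have "s * (t * norm d) \<le> 1"
    proof -
      have "s * (t * norm d) \<le> 1 / (t * (norm d + 1)) * (t * (norm d + 1))"
        using s t pos by (intro mult_mono) (auto simp: s_def)
      then show ?thesis using pos by (simp split: if_splits)
    qed
    then have "u + (s * t) *\<^sub>R d \<in> cball u 1"
      using s t by (simp add: dist_norm abs_mult mult.assoc)
    moreover have "u + (s * t) *\<^sub>R d \<in> Q"
    proof -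
      have "(1 - s) *\<^sub>R u + s *\<^sub>R (u + t *\<^sub>R d) \<in> Q"
        using s assms t by (intro convexD[OF cQ]) auto
      then show ?thesis by (simp add: algebra_simps)
    qed
    ultimately have "u + (s * t) *\<^sub>R d \<in> convex hull V"
      using ab V by blast
    then have "(\<lambda>v. v - u) (u + (s * t) *\<^sub>R d) \<in> convex hull D"
      unfolding D_def using convex_hull_translation[of "- u" V]
      by (auto simp: image_iff intro!: bexI[of _ "u + (s * t) *\<^sub>R d"])
    then have "(s * t) *\<^sub>R d \<in> convex_cone hull D"
      using convex_hull_subset_convex_cone_hull by auto
    then have "(1 / (s * t)) *\<^sub>R ((s * t) *\<^sub>R d) \<in> convex_cone hull D"
      by (rule convex_cone_hull_mul) (use s t in auto)
    moreover have "(1 / (s * t)) *\<^sub>R ((s * t) *\<^sub>R d) = d"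
      using s t by (simp only: scaleR_scaleR) simp
    ultimately show "d \<in> convex_cone hull D"
      by (simp only:)
  qed
  moreover have "D \<subseteq> tangent_cone Q u"
    using V(2) hull_subset[of V convex] by (auto simp: D_def intro!: diff_in_tangent_cone)
  then have "convex_cone hull D \<subseteq> tangent_cone Q u"
    using assms(2) cQ by (intro hull_minimal convex_cone_tangent_cone)
  ultimately show thesis
    using that[of D] V(1) by (auto simp: D_def)
qed

text \<open>Constraints that are strict at \<open>u\<close> survive every sufficiently small step.
  There are finitely many, so one step serves all of them and only the active constraints restrict
  the direction.\<close>

lemma tangent_cone_halfspaces:
  fixes Q :: "'a::euclidean_space set"
  assumes "finite F" "Q = \<Inter>F" "u \<in> Q" "\<And>h. h \<in> F \<Longrightarrow> h = {x. a h \<bullet> x \<le> b h}"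
  shows "tangent_cone Q u = {d. \<forall>h\<in>{h\<in>F. a h \<bullet> u = b h}. a h \<bullet> d \<le> 0}"
proof (intro equalityI subsetI)
  fix d assume "d \<in> tangent_cone Q u"
  then obtain t where t: "t > 0" "u + t *\<^sub>R d \<in> Q"
    by (auto simp: tangent_cone_def)
  have "a h \<bullet> d \<le> 0" if "h \<in> F" "a h \<bullet> u = b h" for h
  proof -
    have "u + t *\<^sub>R d \<in> h" using t that assms(2) by auto
    then have "a h \<bullet> (u + t *\<^sub>R d) \<le> b h" using assms(4)[OF that(1)] by auto
    then show ?thesis using t that by (simp add: inner_add_right mult_le_0_iff)
  qed
  then show "d \<in> {d. \<forall>h\<in>{h\<in>F. a h \<bullet> u = b h}. a h \<bullet> d \<le> 0}" by auto
next
  fix d assume d: "d \<in> {d. \<forall>h\<in>{h\<in>F. a h \<bullet> u = b h}. a h \<bullet> d \<le> 0}"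
  have "\<forall>h\<in>F. \<forall>\<^sub>F t in at_right 0. a h \<bullet> (u + t *\<^sub>R d) \<le> b h"
  proof
    fix h assume h: "h \<in> F"
    have le: "a h \<bullet> u \<le> b h"
      using h assms(2,3) assms(4)[OF h] by auto
    show "\<forall>\<^sub>F t in at_right 0. a h \<bullet> (u + t *\<^sub>R d) \<le> b h"
    proof (cases "a h \<bullet> u = b h")
      case True
      then have "a h \<bullet> d \<le> 0" using d h by auto
      then have "\<forall>\<^sub>F t in at_right 0. t * (a h \<bullet> d) \<le> 0"
        by (auto simp: eventually_at_right_field mult_le_0_iff intro!: exI[of _ 1])
      then show ?thesis using True by (auto simp: inner_add_right elim: eventually_mono)
    next
      case False
      have "((\<lambda>t. a h \<bullet> (u + t *\<^sub>R d)) \<longlongrightarrow> a h \<bullet> (u + 0 *\<^sub>R d)) (at_right 0)"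
        by (intro tendsto_intros)
      moreover have "a h \<bullet> (u + 0 *\<^sub>R d) < b h"
        using le False by auto
      ultimately have "\<forall>\<^sub>F t in at_right 0. a h \<bullet> (u + t *\<^sub>R d) < b h"
        by (rule order_tendstoD(2))
      then show ?thesis by (auto elim: eventually_mono)
    qed
  qed
  then have "\<forall>\<^sub>F t in at_right 0. \<forall>h\<in>F. a h \<bullet> (u + t *\<^sub>R d) \<le> b h"
    using assms(1) by (simp add: eventually_ball_finite)
  moreover have "\<forall>\<^sub>F t in at_right (0::real). t > 0"
    by (simp add: eventually_at_right_less)
  ultimately have "\<forall>\<^sub>F t in at_right 0. t > 0 \<and> (\<forall>h\<in>F. a h \<bullet> (u + t *\<^sub>R d) \<le> b h)"
    by eventually_elim auto
  then obtain t where "t > 0" "\<forall>h\<in>F. a h \<bullet> (u + t *\<^sub>R d) \<le> b h"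
    using eventually_happens' trivial_limit_at_right_real by blast
  then show "d \<in> tangent_cone Q u"
    using assms(2,4) by (auto simp: tangent_cone_def)
qed

text \<open>A tangent cone depends only on the set of active halfspaces, which is one of finitely
  many subsets of \<open>F\<close>.\<close>

lemma finite_tangent_cones:
  fixes Q :: "'a::euclidean_space set"
  assumes "polyhedron Q"
  shows "finite (tangent_cones Q)"
proof -
  obtain F where F: "finite F" "Q = \<Inter>F"
    and "\<forall>h\<in>F. \<exists>a b. a \<noteq> 0 \<and> h = {x. a \<bullet> x \<le> b}"
    using assms by (auto simp: polyhedron_def)
  then obtain a b where ab: "\<And>h. h \<in> F \<Longrightarrow> h = {x. a h \<bullet> x \<le> b h}"
    by metis
  have "tangent_cones Q \<subseteq> (\<lambda>J. {d. \<forall>h\<in>J. a h \<bullet> d \<le> 0}) ` Pow F"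
  proof
    fix T assume "T \<in> tangent_cones Q"
    then obtain u where u: "u \<in> Q" "T = tangent_cone Q u"
      by (auto simp: tangent_cones_def)
    have "T = {d. \<forall>h\<in>{h\<in>F. a h \<bullet> u = b h}. a h \<bullet> d \<le> 0}"
      unfolding u(2) by (rule tangent_cone_halfspaces[OF F u(1) ab])
    then show "T \<in> (\<lambda>J. {d. \<forall>h\<in>J. a h \<bullet> d \<le> 0}) ` Pow F"
      by (rule image_eqI) simp
  qed
  then show ?thesis
    using F(1) by (meson finite_Pow_iff finite_imageI finite_subset)
qed

text \<open>The point \<open>w\<close> lies halfway along a feasible step in direction
  \<open>d\<close>, so one can also move back. The last conclusion lets a linear inequality on the
  old cone pass to the new one when the functional vanishes on \<open>d\<close>.\<close>

lemma tangent_cone_along_direction: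
  assumes "convex Q" "u \<in> Q" "d \<in> tangent_cone Q u"
  obtains w where "w \<in> Q" "tangent_cone Q u \<subseteq> tangent_cone Q w" "- d \<in> tangent_cone Q w"
    "\<And>e. e \<in> tangent_cone Q w \<Longrightarrow> \<exists>t>0. \<exists>s>0. t *\<^sub>R d + s *\<^sub>R e \<in> tangent_cone Q u"
proof -
  obtain t where t: "t > 0" "u + t *\<^sub>R d \<in> Q"
    using assms by (auto simp: tangent_cone_def)
  define w where "w = u + (t / 2) *\<^sub>R d"
  have w: "w = (1/2) *\<^sub>R u + (1/2) *\<^sub>R (u + t *\<^sub>R d)"
    by (simp add: w_def scaleR_add_right flip: scaleR_add_left)
  show thesis
  proof
    show "w \<in> Q"
      unfolding w using assms t by (intro convexD[OF assms(1)]) auto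
    show "- d \<in> tangent_cone Q w"
      using t assms by (auto simp: tangent_cone_def w_def intro!: exI[of _ "t / 2"])
    show "tangent_cone Q u \<subseteq> tangent_cone Q w"
    proof
      fix e assume "e \<in> tangent_cone Q u"
      then obtain s where s: "s > 0" "u + s *\<^sub>R e \<in> Q"
        by (auto simp: tangent_cone_def)
      have "(1/2) *\<^sub>R (u + t *\<^sub>R d) + (1/2) *\<^sub>R (u + s *\<^sub>R e) \<in> Q"
        using s t by (intro convexD[OF assms(1)]) auto
      also have "(1/2) *\<^sub>R (u + t *\<^sub>R d) + (1/2) *\<^sub>R (u + s *\<^sub>R e) = w + (s / 2) *\<^sub>R e"
        by (simp add: w algebra_simps)
      finally show "e \<in> tangent_cone Q w"
        using s by (auto simp: tangent_cone_def intro!: exI[of _ "s / 2"])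
    qed
    fix e assume "e \<in> tangent_cone Q w"
    then obtain s where s: "s > 0" "w + s *\<^sub>R e \<in> Q"
      by (auto simp: tangent_cone_def)
    then have "(w + s *\<^sub>R e) - u \<in> tangent_cone Q u"
      by (intro diff_in_tangent_cone)
    then have "(t / 2) *\<^sub>R d + s *\<^sub>R e \<in> tangent_cone Q u"
      by (simp add: w_def algebra_simps)
    then show "\<exists>t>0. \<exists>s>0. t *\<^sub>R d + s *\<^sub>R e \<in> tangent_cone Q u"
      using s t by (intro exI[of _ "t / 2"] conjI exI[of _ s]) auto
  qed
qed

section \<open>Separation and enlargement of cones\<close>

text \<open>The separating level \<open>b\<close> is negative because the cone contains 0. A cone
  element with negative value could be rescaled to have value exactly \<open>b\<close>, against
  strictness, so the level can be moved to 0.\<close>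

lemma separate_closed_convex_cone:
  fixes K :: "'a::euclidean_space set"
  assumes "convex_cone K" "closed K" "z \<notin> K"
  obtains q where "q \<bullet> z > 0" "\<And>k. k \<in> K \<Longrightarrow> q \<bullet> k \<le> 0"
proof -
  have "convex K" using assms(1) by (simp add: convex_cone_def)
  then obtain a b where ab: "a \<bullet> z < b" "\<And>k. k \<in> K \<Longrightarrow> a \<bullet> k > b"
    using separating_hyperplane_closed_point[OF _ assms(2,3)] by blast
  have b: "b < 0"
    using ab(2)[OF convex_cone_contains_0[OF assms(1)]] by simp
  have "a \<bullet> k \<ge> 0" if k: "k \<in> K" for k
  proof (rule ccontr)
    assume "\<not> a \<bullet> k \<ge> 0"
    then have neg: "a \<bullet> k < 0" by simp
    then have "(b / (a \<bullet> k)) *\<^sub>R k \<in> K"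
      using b k by (intro convex_cone_scaleR[OF assms(1)]) (auto simp: divide_nonpos_neg)
    from ab(2)[OF this] show False using neg by simp
  qed
  then show thesis
    using ab b by (intro that[of "- a"]) auto
qed

text \<open>Finite generation is what makes this work: the image is generated by the images of the
  generators, and finitely generated cones are closed.\<close>

lemma closed_linear_image_convex_cone_hull:
  fixes f :: "'a::euclidean_space \<Rightarrow> 'b::euclidean_space"
  assumes "linear f" "finite D"
  shows "closed (f ` (convex_cone hull D))"
  using assms by (metis closed_convex_cone_hull convex_cone_hull_linear_image finite_imageI)

lemma sv_Im_cone_map: "sv_Im (cone_map T) = snd ` T"
  by (force simp: sv_Im_def cone_map_def)

text \<open>The set of multipliers \<open>(p, q')\<close> with \<open>p\<close> fixed is exhausted by enlarging the cone: if the
  image of a maximal \<open>T\<close> is separated from some \<open>- y\<^sub>0\<close> by \<open>q'\<close>, then \<open>(p, q - s q')\<close> with the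
  largest admissible \<open>s\<close> vanishes on a generator \<open>d\<close> of \<open>T\<close> along which \<open>(0, q')\<close> is negative, and
  moving the base point along \<open>d\<close> enlarges the cone.\<close>

lemma polar_surj_cone:
  fixes G :: "('a::euclidean_space \<times> 'b::euclidean_space) set"
  assumes G: "polyhedron G" "z \<in> G" and pq: "\<And>d. d \<in> tangent_cone G z \<Longrightarrow> (p, q) \<bullet> d \<le> 0"
  obtains T q' where "T \<in> surj_cones G" "tangent_cone G z \<subseteq> T" "\<And>d. d \<in> T \<Longrightarrow> (p, q') \<bullet> d \<le> 0"
proof -
  \<comment> \<open>These are the tangent cones above the given one that still admit a multiplier
    with first component \<open>p\<close>. The family is finite and nonempty, so it has an
    inclusion-maximal member.\<close>
  define \<A> where "\<A> = {T \<in> tangent_cones G. tangent_cone G z \<subseteq> T \<and> (\<exists>q. \<forall>d\<in>T. (p, q) \<bullet> d \<le> 0)}"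
  have "finite \<A>"
    using finite_tangent_cones[OF G(1)] by (simp add: \<A>_def)
  moreover have "tangent_cone G z \<in> \<A>"
    using G(2) pq unfolding \<A>_def tangent_cones_def by blast
  ultimately obtain T where T: "T \<in> \<A>" and max: "\<And>T'. T' \<in> \<A> \<Longrightarrow> T \<subseteq> T' \<Longrightarrow> T = T'"
    using finite_has_maximal[of \<A>] by blast
  obtain u r where u: "u \<in> G" "T = tangent_cone G u" and zT: "tangent_cone G z \<subseteq> T"
    and r: "\<And>d. d \<in> T \<Longrightarrow> (p, r) \<bullet> d \<le> 0"
    using T unfolding \<A>_def tangent_cones_def by blast
  obtain D where D: "finite D" "T = convex_cone hull D"
    using tangent_cone_finitely_generated[OF G(1) u(1)] u(2) by metis
  have cG: "convex G" using G(1) by (rule polyhedron_imp_convex)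
  define C where "C = snd ` T"
  have C: "convex_cone C" "closed C"
    using D convex_cone_linear_image[of T snd] linear_snd
      closed_linear_image_convex_cone_hull[OF linear_snd D(1)]
    by (auto simp: C_def convex_cone_convex_cone_hull)
  \<comment> \<open>A convex cone closed under negation is a subspace, so this is all that relative
    surjectivity of \<open>T\<close> requires.\<close>
  have "- y \<in> C" if y: "y \<in> C" for y
  proof (rule ccontr)
    assume "- y \<notin> C"
    then obtain q' where q': "q' \<bullet> (- y) > 0" "\<And>k. k \<in> C \<Longrightarrow> q' \<bullet> k \<le> 0"
      using separate_closed_convex_cone[OF C] by metis
    have q'T: "(0, q') \<bullet> d \<le> 0" if "d \<in> T" for d
      using q'(2)[of "snd d"] that by (cases d) (force simp: C_def)
    obtain d\<^sub>0 where d\<^sub>0: "d\<^sub>0 \<in> T" "snd d\<^sub>0 = y" using y by (auto simp: C_def)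
    define N where "N = {d \<in> D. (0, q') \<bullet> d < 0}"
    \<comment> \<open>Otherwise \<open>q'\<close> would be nonnegative on all generators, hence on
      all of \<open>T\<close>, whereas it is negative at \<open>d\<^sub>0\<close>.\<close>
    have "N \<noteq> {}"
    proof
      assume "N = {}"
      then have "D \<subseteq> {d. (0, - q') \<bullet> d \<le> 0}"
        by (auto simp: N_def not_less)
      then have "T \<subseteq> {d. (0, - q') \<bullet> d \<le> 0}"
        unfolding D(2) by (intro hull_minimal convex_cone_halfspace_le)
      then show False using d\<^sub>0 q'(1) by (cases d\<^sub>0) auto
    qed
    moreover have "finite N" using D(1) by (simp add: N_def)
    ultimately obtain d where d: "d \<in> N"
      and dmin: "\<And>e. e \<in> N \<Longrightarrow> ((p, r) \<bullet> d) / ((0, q') \<bullet> d) \<le> ((p, r) \<bullet> e) / ((0, q') \<bullet> e)"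
      using arg_min_if_finite(1)[of N "\<lambda>d. ((p, r) \<bullet> d) / ((0, q') \<bullet> d)"]
        arg_min_least[of N _ "\<lambda>d. ((p, r) \<bullet> d) / ((0, q') \<bullet> d)"] by blast
    define s where "s = ((p, r) \<bullet> d) / ((0, q') \<bullet> d)"
    have split: "(p, r - s *\<^sub>R q') \<bullet> e = (p, r) \<bullet> e - s * ((0, q') \<bullet> e)" for e
      by (cases e) (simp add: algebra_simps)
    have DT: "D \<subseteq> T" unfolding D(2) by (rule hull_subset)
    have d_neg: "(0, q') \<bullet> d < 0" and dT: "d \<in> T" using d DT by (auto simp: N_def)
    have "D \<subseteq> {e. (p, r - s *\<^sub>R q') \<bullet> e \<le> 0}"
    proof
      fix e assume e: "e \<in> D"
      show "e \<in> {e. (p, r - s *\<^sub>R q') \<bullet> e \<le> 0}"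
      proof (cases "e \<in> N")
        case True
        then have "s \<le> ((p, r) \<bullet> e) / ((0, q') \<bullet> e)" "(0, q') \<bullet> e < 0"
          using dmin by (auto simp: s_def N_def)
        then have "(p, r) \<bullet> e \<le> s * ((0, q') \<bullet> e)"
          by (simp only: neg_le_divide_eq)
        then show ?thesis by (simp only: split mem_Collect_eq diff_le_0_iff_le)
      next
        case False
        then have "(0, q') \<bullet> e = 0" using q'T[of e] e DT by (force simp: N_def)
        then show ?thesis using r[of e] e DT by (simp only: split mem_Collect_eq) auto
      qed
    qed
    then have polar: "T \<subseteq> {e. (p, r - s *\<^sub>R q') \<bullet> e \<le> 0}"
      unfolding D(2) by (intro hull_minimal convex_cone_halfspace_le)
    have zero: "(p, r - s *\<^sub>R q') \<bullet> d = 0"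
      using split[of d] d_neg unfolding s_def by (metis diff_self less_irrefl nonzero_eq_divide_eq)
    obtain w where w: "w \<in> G" "T \<subseteq> tangent_cone G w" "- d \<in> tangent_cone G w"
      "\<And>e. e \<in> tangent_cone G w \<Longrightarrow> \<exists>t>0. \<exists>s>0. t *\<^sub>R d + s *\<^sub>R e \<in> T"
      using tangent_cone_along_direction[OF cG u(1), of d] dT unfolding u(2) by metis
    have "(p, r - s *\<^sub>R q') \<bullet> e \<le> 0" if "e \<in> tangent_cone G w" for e
    proof -
      obtain t c where tc: "t > 0" "c > 0" "t *\<^sub>R d + c *\<^sub>R e \<in> T"
        using w(4)[OF \<open>e \<in> tangent_cone G w\<close>] by blast
      then have "(p, r - s *\<^sub>R q') \<bullet> (t *\<^sub>R d + c *\<^sub>R e) \<le> 0"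
        using polar by blast
      then have "c * ((p, r - s *\<^sub>R q') \<bullet> e) \<le> 0"
        by (simp only: inner_add_right inner_scaleR_right zero mult_zero_right add_0_left)
      then show ?thesis using tc(2) by (simp add: mult_le_0_iff)
    qed
    then have "tangent_cone G w \<in> \<A>"
      using w(1,2) zT unfolding \<A>_def tangent_cones_def by blast
    \<comment> \<open>The cone at \<open>w\<close> belongs to the family and contains
      \<open>T\<close>, so maximality makes them equal. Then \<open>q'\<close> is nonpositive at
      both \<open>d\<close> and \<open>- d\<close>, yet negative at \<open>d\<close>.\<close>
    then have "- d \<in> T" using max[OF _ w(2)] w(3) by auto
    then have "\<not> (0, q') \<bullet> d < 0"
      using q'T[of "- d"] by (simp only: inner_minus_right neg_le_0_iff_le not_less)
    then show False using d_neg by contradiction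
  qed
  then have "subspace C"
    using C(1) by (simp add: subspace_convex_cone_symmetric)
  then have "T \<in> surj_cones G"
    using T by (auto simp: surj_cones_def relatively_surjective_def sv_Im_cone_map C_def \<A>_def)
  then show thesis using that zT r by blast
qed

subsection \<open>Arbitrary norms and inverse norms of cones\<close>

lemma is_normD:
  assumes "is_norm N"
  shows is_norm_nonneg: "0 \<le> N x" and is_norm_eq_0: "N x = 0 \<longleftrightarrow> x = 0"
    and is_norm_scaleR: "N (c *\<^sub>R x) = \<bar>c\<bar> * N x" and is_norm_triangle: "N (x + y) \<le> N x + N y"
  using assms by (auto simp: is_norm_def)

lemma is_norm_0: "is_norm N \<Longrightarrow> N 0 = 0"
  by (simp add: is_norm_eq_0)

lemma is_norm_minus: "is_norm N \<Longrightarrow> N (- x) = N x"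
  using is_norm_scaleR[of N "-1" x] by simp

lemma is_norm_minus_commute: "is_norm N \<Longrightarrow> N (x - y) = N (y - x)"
  using is_norm_minus[of N "x - y"] by simp

lemma is_norm_convex:
  assumes "is_norm N" "0 \<le> s" "0 \<le> t"
  shows "N (s *\<^sub>R x + t *\<^sub>R y) \<le> s * N x + t * N y"
  using is_norm_triangle[OF assms(1), of "s *\<^sub>R x" "t *\<^sub>R y"] assms(2,3)
  by (simp add: is_norm_scaleR[OF assms(1)])

lemma convex_on_is_norm: "is_norm N \<Longrightarrow> convex_on UNIV N"
  unfolding convex_on_def by (simp add: is_norm_convex)

lemma continuous_on_is_norm:
  fixes N :: "'a::euclidean_space \<Rightarrow> real"
  assumes "is_norm N"
  shows "continuous_on A N"
  by (rule continuous_on_subset[OF convex_on_continuous[OF open_UNIV convex_on_is_norm[OF assms]]]) auto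

text \<open>The constant is the minimum of \<open>N\<close> on the Euclidean unit sphere, which is
  attained by compactness and positive by definiteness.\<close>

lemma is_norm_equivalence:
  fixes N :: "'a::euclidean_space \<Rightarrow> real"
  assumes "is_norm N"
  obtains c where "c > 0" "\<And>x. c * norm x \<le> N x"
proof -
  obtain e :: 'a where "e \<in> Basis" using nonempty_Basis by blast
  then have "sphere (0::'a) 1 \<noteq> {}" by (auto intro!: exI[of _ e])
  then obtain z where z: "z \<in> sphere (0::'a) 1" "\<And>y. y \<in> sphere 0 1 \<Longrightarrow> N z \<le> N y"
    using continuous_attains_inf[OF compact_sphere _ continuous_on_is_norm[OF assms]] by metis
  have "N z \<noteq> 0" using z(1) is_norm_eq_0[OF assms, of z] by auto
  then have "N z > 0" using is_norm_nonneg[OF assms, of z] by simp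
  moreover have "N z * norm x \<le> N x" for x
  proof (cases "x = 0")
    case False
    then have "N z \<le> N (sgn x)" using z(2)[of "sgn x"] by (simp add: norm_sgn)
    then show ?thesis
      using False by (simp add: sgn_div_norm is_norm_scaleR[OF assms] field_simps)
  qed (simp add: is_norm_0[OF assms])
  ultimately show thesis using that by blast
qed

lemma bounded_is_norm_ball:
  fixes N :: "'a::euclidean_space \<Rightarrow> real"
  assumes "is_norm N"
  shows "bounded {x. N (u - x) \<le> r}"
proof -
  obtain c where c: "c > 0" "\<And>x. c * norm x \<le> N x"
    using is_norm_equivalence[OF assms] by metis
  have "{x. N (u - x) \<le> r} \<subseteq> cball u (r / c)"
    using c(1) order_trans[OF c(2)] by (auto simp: dist_norm pos_le_divide_eq mult.commute[of _ c])
  then show ?thesis using bounded_cball bounded_subset by blast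
qed

lemma compact_Int_is_norm_ball:
  fixes N :: "'a::euclidean_space \<Rightarrow> real"
  assumes "is_norm N" "closed S"
  shows "compact (S \<inter> {x. N (u - x) \<le> r})"
proof -
  have "closed {x. N (u - x) \<le> r}"
    by (intro closed_Collect_le continuous_intros continuous_on_compose2[OF continuous_on_is_norm[OF assms(1)]]) auto
  then show ?thesis
    using assms(2) bounded_is_norm_ball[OF assms(1)]
    by (auto simp: compact_eq_bounded_closed intro: bounded_subset)
qed

lemma norm_dist_le:
  assumes "is_norm N" "x \<in> S"
  shows "norm_dist N u S \<le> N (u - x)"
  unfolding norm_dist_def
  using assms by (intro cINF_lower) (auto intro: is_norm_nonneg intro!: bdd_belowI[of _ 0])

text \<open>Only points at least as close as some fixed \<open>s\<close> in \<open>S\<close> matter,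
  and these form a compact set.\<close>

lemma norm_dist_attained:
  fixes N :: "'a::euclidean_space \<Rightarrow> real"
  assumes N: "is_norm N" and S: "closed S" "S \<noteq> {}"
  obtains x where "x \<in> S" "norm_dist N u S = N (u - x)" "\<And>y. y \<in> S \<Longrightarrow> N (u - x) \<le> N (u - y)"
proof -
  obtain s where s: "s \<in> S" using S by auto
  have "continuous_on A (\<lambda>x. N (u - x))" for A
    by (intro continuous_intros continuous_on_compose2[OF continuous_on_is_norm[OF N]]) auto
  then obtain x where x: "x \<in> S \<inter> {x. N (u - x) \<le> N (u - s)}"
    and le: "\<And>y. y \<in> S \<inter> {x. N (u - x) \<le> N (u - s)} \<Longrightarrow> N (u - x) \<le> N (u - y)"
    using continuous_attains_inf[OF compact_Int_is_norm_ball[OF N S(1), of u "N (u - s)"],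
        of "\<lambda>x. N (u - x)"] s by blast
  have min: "N (u - x) \<le> N (u - y)" if "y \<in> S" for y
    using le[of y] x that by fastforce
  then have "N (u - x) \<le> norm_dist N u S"
    unfolding norm_dist_def using S by (intro cINF_greatest)
  with that min x norm_dist_le[OF N, of x S u] show thesis by force
qed

section \<open>Separation from a norm ball and a Farkas lemma\<close>

text \<open>A hyperplane separates \<open>S\<close> from the open ball of radius \<open>r\<close>
  around \<open>u\<close>. Its normal, rescaled to dual norm at most 1, is the functional
  \<open>p\<close>.\<close>

lemma separate_from_norm_ball:
  fixes N :: "'a::euclidean_space \<Rightarrow> real"
  assumes N: "is_norm N" and S: "convex S" "S \<noteq> {}" and r: "r > 0"
    and far: "\<And>s. s \<in> S \<Longrightarrow> r \<le> N (s - u)"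
  obtains p where "\<And>h. p \<bullet> h \<le> N h" "\<And>s. s \<in> S \<Longrightarrow> r \<le> p \<bullet> (s - u)"
proof -
  define B where "B = {x. N (x - u) < r}"
  have "convex B"
  proof (rule convexI)
    fix x y and a b :: real
    assume xy: "x \<in> B" "y \<in> B" and ab: "0 \<le> a" "0 \<le> b" "a + b = 1"
    have eq: "a *\<^sub>R x + b *\<^sub>R y - u = a *\<^sub>R (x - u) + b *\<^sub>R (y - u)"
    proof -
      have "u = a *\<^sub>R u + b *\<^sub>R u" by (metis ab(3) scaleR_add_left scaleR_one)
      then show ?thesis by (simp add: algebra_simps)
    qed
    have "N (a *\<^sub>R (x - u) + b *\<^sub>R (y - u)) \<le> a * N (x - u) + b * N (y - u)"
      using ab(1,2) by (rule is_norm_convex[OF N])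
    also have "\<dots> < r"
      using xy ab by (intro convex_bound_lt) (auto simp: B_def)
    finally show "a *\<^sub>R x + b *\<^sub>R y \<in> B"
      by (simp add: B_def eq)
  qed
  moreover have "u \<in> B" using r by (simp add: B_def is_norm_0[OF N])
  moreover have "B \<inter> S = {}" using far by (force simp: B_def)
  ultimately obtain a c where a: "a \<noteq> 0" "\<And>x. x \<in> B \<Longrightarrow> a \<bullet> x \<le> c" "\<And>s. s \<in> S \<Longrightarrow> c \<le> a \<bullet> s"
    using separating_hyperplane_sets[of B S] S by blast
  \<comment> \<open>After translating \<open>u\<close> to the origin, \<open>g\<close> bounds the
    functional: a \<bullet> h \<le> g whenever \<open>N h < r\<close>.\<close>
  define g where "g = c - a \<bullet> u"
  have g: "r * (a \<bullet> h) \<le> g * N h" for h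
  proof (cases "h = 0")
    case False
    then have Nh: "N h > 0"
      using is_norm_nonneg[OF N, of h] is_norm_eq_0[OF N, of h] by simp
    show ?thesis
    \<comment> \<open>The ball is open, so \<open>h\<close> is scaled to norm \<open>z * r\<close>
      with \<open>z < 1\<close>, and the inequality follows in the limit as \<open>z\<close> tends
      to 1.\<close>
    proof (rule field_le_mult_one_interval)
      fix z :: real assume z: "0 < z" "z < 1"
      have "u + (z * r / N h) *\<^sub>R h \<in> B"
        using z r Nh by (simp add: B_def is_norm_scaleR[OF N])
      from a(2)[OF this] have "(z * r / N h) * (a \<bullet> h) \<le> g"
        by (simp add: g_def inner_add_right)
      then show "z * (r * (a \<bullet> h)) \<le> g * N h"
        using Nh by (simp add: field_simps)
    qed
  qed (simp add: is_norm_0[OF N])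
  \<comment> \<open>Testing the inequality at \<open>h = a\<close> shows that \<open>g\<close> is
    positive, so scaling by \<open>r / g\<close> is legitimate.\<close>
  have "r * (a \<bullet> a) > 0" using a(1) r by simp
  then have "g * N a > 0" using g[of a] by linarith
  then have gpos: "g > 0" using is_norm_nonneg[OF N, of a] by (auto simp: zero_less_mult_iff)
  show thesis
  proof (rule that[of "(r / g) *\<^sub>R a"])
    show "((r / g) *\<^sub>R a) \<bullet> h \<le> N h" for h
      using g[of h] gpos by (simp add: field_simps)
    show "r \<le> ((r / g) *\<^sub>R a) \<bullet> (s - u)" if "s \<in> S" for s
    proof -
      have "r * g \<le> r * (a \<bullet> s - a \<bullet> u)"
        using a(3)[OF that] r by (intro mult_left_mono) (auto simp: g_def)
      then show ?thesis using gpos by (simp add: field_simps inner_diff_right)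
    qed
  qed
qed

text \<open>The map \<open>f\<close> replaces the first component by its product with
  \<open>p\<close>, and the hypothesis says that the image cone misses \<open>(1, 0)\<close>. A
  separating functional has positive first coordinate \<alpha>, and dividing by \<alpha> restores
  \<open>p\<close> as the fixed component.\<close>

lemma farkas_fixed_component:
  fixes D :: "('a::euclidean_space \<times> 'b::euclidean_space) set"
  assumes D: "finite D" and p: "\<And>w. (w, 0) \<in> convex_cone hull D \<Longrightarrow> p \<bullet> w \<le> 0"
  obtains q where "\<And>d. d \<in> convex_cone hull D \<Longrightarrow> (p, q) \<bullet> d \<le> 0"
proof -
  define f where "f = (\<lambda>d::'a \<times> 'b. (p \<bullet> fst d, snd d))"
  define K where "K = f ` (convex_cone hull D)"
  have f: "linear f"
    by (auto simp: f_def linear_iff inner_add_right)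
  have K: "convex_cone K" "closed K"
    using D f convex_cone_linear_image convex_cone_convex_cone_hull
    by (auto simp: K_def intro: closed_linear_image_convex_cone_hull)
  have "(1, 0) \<notin> K"
    using p by (force simp: K_def f_def)
  then obtain k where k: "k \<bullet> (1, 0) > 0" "\<And>z. z \<in> K \<Longrightarrow> k \<bullet> z \<le> 0"
    using separate_closed_convex_cone[OF K] by metis
  obtain \<alpha> q where kq: "k = (\<alpha>, q)" by (cases k)
  have \<alpha>: "\<alpha> > 0" using k(1) kq by simp
  show thesis
  proof (rule that[of "(1 / \<alpha>) *\<^sub>R q"])
    fix d assume "d \<in> convex_cone hull D"
    then have "k \<bullet> f d \<le> 0" using k(2) by (auto simp: K_def)
    then show "(p, (1 / \<alpha>) *\<^sub>R q) \<bullet> d \<le> 0"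
      using \<alpha> by (cases d) (simp add: kq f_def field_simps)
  qed
qed

section \<open>The minimal norm of a preimage under a cone\<close>

text \<open>This is the inner infimum of \<open>inv_norm\<close> as a function of \<open>y\<close>.
  It is isolated because it is sublinear on the image of a convex cone. Outside that image the
  infimum ranges over the empty set, hence the membership hypotheses below.\<close>

definition cone_inv_norm :: "('a \<Rightarrow> real) \<Rightarrow> ('a \<times> 'b) set \<Rightarrow> 'b \<Rightarrow> real" where
  "cone_inv_norm N T y = (INF x\<in>{x. (x, y) \<in> T}. N x)"

lemma inv_norm_cone_map:
  "inv_norm NX NY (cone_map T) = (SUP y\<in>{y \<in> snd ` T. NY y \<le> 1}. cone_inv_norm NX T y)"
  unfolding inv_norm_def sv_Im_cone_map cone_inv_norm_def sv_inv_def cone_map_def by simp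

lemma cone_inv_norm_le:
  assumes "is_norm N" "(x, y) \<in> T"
  shows "cone_inv_norm N T y \<le> N x"
  unfolding cone_inv_norm_def
  using assms by (intro cINF_lower) (auto intro: is_norm_nonneg intro!: bdd_belowI[of _ 0])

lemma cone_inv_norm_greatest:
  assumes "y \<in> snd ` T" "\<And>x. (x, y) \<in> T \<Longrightarrow> c \<le> N x"
  shows "c \<le> cone_inv_norm N T y"
  unfolding cone_inv_norm_def using assms by (intro cINF_greatest) auto

lemma cone_inv_norm_nonneg:
  "is_norm N \<Longrightarrow> y \<in> snd ` T \<Longrightarrow> 0 \<le> cone_inv_norm N T y"
  by (intro cone_inv_norm_greatest is_norm_nonneg)

lemma cone_inv_norm_0:
  assumes "is_norm N" "convex_cone T"
  shows "cone_inv_norm N T 0 = 0"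
proof -
  have "(0, 0) \<in> T"
    using convex_cone_contains_0[OF assms(2)] by (simp add: zero_prod_def)
  then have "cone_inv_norm N T 0 \<le> 0" "0 \<in> snd ` T"
    using cone_inv_norm_le[OF assms(1)] is_norm_0[OF assms(1)] by force+
  then show ?thesis using cone_inv_norm_nonneg[OF assms(1)] by (intro antisym)
qed

lemma cone_inv_norm_scaleR:
  assumes N: "is_norm N" and T: "convex_cone T" and y: "y \<in> snd ` T" and t: "t > 0"
  shows "cone_inv_norm N T (t *\<^sub>R y) = t * cone_inv_norm N T y"
proof -
  \<comment> \<open>Stated for all \<open>y\<close> and \<open>t\<close>, because the reverse
    inequality is this one at \<open>t *\<^sub>R y\<close> with factor \<open>1 / t\<close>.\<close>
  have le: "cone_inv_norm N T (t *\<^sub>R y) \<le> t * cone_inv_norm N T y"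
    if y: "y \<in> snd ` T" and t: "t > 0" for t y
  proof -
    have "cone_inv_norm N T (t *\<^sub>R y) / t \<le> cone_inv_norm N T y"
    proof (rule cone_inv_norm_greatest[OF y])
      fix x assume "(x, y) \<in> T"
      then have "t *\<^sub>R (x, y) \<in> T"
        using t by (intro convex_cone_scaleR[OF T]) auto
      then have "cone_inv_norm N T (t *\<^sub>R y) \<le> t * N x"
        using cone_inv_norm_le[OF N, of "t *\<^sub>R x"] t by (simp add: is_norm_scaleR[OF N])
      then show "cone_inv_norm N T (t *\<^sub>R y) / t \<le> N x"
        using t by (simp add: field_simps)
    qed
    then show ?thesis using t by (simp add: field_simps)
  qed
  have "t *\<^sub>R y \<in> snd ` T"
    using y t convex_cone_scaleR[OF T, of t] by (force simp: image_iff)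
  from le[OF this, of "1 / t"] have "cone_inv_norm N T y \<le> cone_inv_norm N T (t *\<^sub>R y) / t"
    using t by simp
  then show ?thesis using le[OF y t] t by (intro antisym) (auto simp: field_simps)
qed

text \<open>Preimages of \<open>y\<close> and \<open>z\<close> add up to a preimage of
  \<open>y + z\<close>. The two infima are taken one after the other.\<close>

lemma cone_inv_norm_add:
  assumes N: "is_norm N" and T: "convex_cone T" and y: "y \<in> snd ` T" "z \<in> snd ` T"
  shows "cone_inv_norm N T (y + z) \<le> cone_inv_norm N T y + cone_inv_norm N T z"
proof -
  have "cone_inv_norm N T (y + z) - cone_inv_norm N T z \<le> cone_inv_norm N T y"
  proof (rule cone_inv_norm_greatest[OF y(1)])
    fix x assume x: "(x, y) \<in> T"
    have "cone_inv_norm N T (y + z) - N x \<le> cone_inv_norm N T z"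
    proof (rule cone_inv_norm_greatest[OF y(2)])
      fix w assume "(w, z) \<in> T"
      then have "(x + w, y + z) \<in> T"
        using convex_cone_add[OF T x, of "(w, z)"] by simp
      then show "cone_inv_norm N T (y + z) - N x \<le> N w"
        using cone_inv_norm_le[OF N, of "x + w" "y + z" T] is_norm_triangle[OF N, of x w] by simp
    qed
    then show "cone_inv_norm N T (y + z) - cone_inv_norm N T z \<le> N x" by simp
  qed
  then show ?thesis by simp
qed

text \<open>The unit ball of the image lies in a polytope inside the image. Choosing preimages for
  the finitely many points of \<open>W\<close> that span it bounds the minimal preimage norm on the
  whole polytope by convexity.\<close>

lemma cone_inv_norm_bdd_above:
  fixes D :: "('a::euclidean_space \<times> 'b::euclidean_space) set"
  assumes NX: "is_norm NX" and NY: "is_norm NY" and D: "finite D" "T = convex_cone hull D"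
  shows "bdd_above (cone_inv_norm NX T ` {y \<in> snd ` T. NY y \<le> 1})"
proof -
  have "snd ` T = convex_cone hull (snd ` D)"
    unfolding D(2) by (rule convex_cone_hull_linear_image[OF linear_snd, symmetric])
  then have "polyhedron (snd ` T)"
    using D(1) polyhedron_convex_cone_hull[of "snd ` D"] by simp
  moreover obtain a b where ab: "{y. NY (0 - y) \<le> 1} \<subseteq> cbox a b"
    using bounded_is_norm_ball[OF NY] bounded_subset_cbox_symmetric by metis
  ultimately have "polytope (snd ` T \<inter> cbox a b)"
    by (simp add: bounded_Int polytope_eq_bounded_polyhedron)
  then obtain W where W: "finite W" "snd ` T \<inter> cbox a b = convex hull W"
    by (auto simp: polytope_def)
  have "\<forall>w\<in>W. \<exists>x. (x, w) \<in> T"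
    using hull_subset[of W convex] W(2) by force
  then obtain f where f: "\<And>w. w \<in> W \<Longrightarrow> (f w, w) \<in> T" by metis
  define K where "K = (\<Sum>w\<in>W. NX (f w))"
  have "convex T" unfolding D(2) by (rule convex_convex_cone_hull)
  have "convex {y. \<exists>x. (x, y) \<in> T \<and> NX x \<le> K}"
  proof (rule convexI)
    fix y z and s t :: real
    assume "y \<in> {y. \<exists>x. (x, y) \<in> T \<and> NX x \<le> K}" "z \<in> {y. \<exists>x. (x, y) \<in> T \<and> NX x \<le> K}"
      and st: "0 \<le> s" "0 \<le> t" "s + t = 1"
    then obtain x w where xw: "(x, y) \<in> T" "NX x \<le> K" "(w, z) \<in> T" "NX w \<le> K" by auto
    have "(s *\<^sub>R x + t *\<^sub>R w, s *\<^sub>R y + t *\<^sub>R z) \<in> T"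
      using convexD[OF \<open>convex T\<close> xw(1,3) st] by simp
    moreover have "NX (s *\<^sub>R x + t *\<^sub>R w) \<le> s * NX x + t * NX w"
      using st(1,2) by (rule is_norm_convex[OF NX])
    moreover have "s * NX x + t * NX w \<le> K"
      using xw st by (intro convex_bound_le)
    ultimately show "s *\<^sub>R y + t *\<^sub>R z \<in> {y. \<exists>x. (x, y) \<in> T \<and> NX x \<le> K}"
      by force
  qed
  moreover have "NX (f w) \<le> K" if "w \<in> W" for w
    unfolding K_def using that W(1) is_norm_nonneg[OF NX] by (intro member_le_sum) auto
  then have "W \<subseteq> {y. \<exists>x. (x, y) \<in> T \<and> NX x \<le> K}"
    using f by blast
  ultimately have sub: "convex hull W \<subseteq> {y. \<exists>x. (x, y) \<in> T \<and> NX x \<le> K}"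
    by (intro hull_minimal)
  have "cone_inv_norm NX T y \<le> K" if y: "y \<in> snd ` T" "NY y \<le> 1" for y
  proof -
    have "y \<in> convex hull W"
      unfolding W(2)[symmetric] using ab y by (auto simp: is_norm_minus[OF NY])
    then obtain x where "(x, y) \<in> T" "NX x \<le> K" using sub by auto
    then show ?thesis using cone_inv_norm_le[OF NX, of x y T] by linarith
  qed
  then show ?thesis by (intro bdd_aboveI[of _ K]) auto
qed

lemma cone_inv_norm_le_inv_norm:
  fixes D :: "('a::euclidean_space \<times> 'b::euclidean_space) set"
  assumes NX: "is_norm NX" and NY: "is_norm NY" and D: "finite D" "T = convex_cone hull D"
    and y: "y \<in> snd ` T"
  shows "cone_inv_norm NX T y \<le> inv_norm NX NY (cone_map T) * NY y"
proof (cases "y = 0")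
  case True
  have "convex_cone T" unfolding D(2) by (rule convex_cone_convex_cone_hull)
  then show ?thesis using True by (simp add: cone_inv_norm_0[OF NX] is_norm_0[OF NY])
next
  case False
  then have pos: "NY y > 0"
    using is_norm_nonneg[OF NY, of y] is_norm_eq_0[OF NY, of y] by simp
  have T: "convex_cone T" unfolding D(2) by (rule convex_cone_convex_cone_hull)
  define z where "z = (1 / NY y) *\<^sub>R y"
  have z: "z \<in> snd ` T"
    using y pos convex_cone_scaleR[OF T, of "1 / NY y"] by (force simp: z_def image_iff)
  have "NY z \<le> 1" using pos by (simp add: z_def is_norm_scaleR[OF NY])
  with z have "cone_inv_norm NX T z \<le> inv_norm NX NY (cone_map T)"
    unfolding inv_norm_cone_map by (intro cSUP_upper cone_inv_norm_bdd_above[OF NX NY D]) auto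
  moreover have "cone_inv_norm NX T z = (1 / NY y) * cone_inv_norm NX T y"
    unfolding z_def by (intro cone_inv_norm_scaleR NX T y) (use pos in auto)
  ultimately show ?thesis using pos by (simp add: field_simps)
qed

lemma inv_norm_nonneg:
  fixes D :: "('a::euclidean_space \<times> 'b::euclidean_space) set"
  assumes NX: "is_norm NX" and NY: "is_norm NY" and D: "finite D" "T = convex_cone hull D"
  shows "0 \<le> inv_norm NX NY (cone_map T)"
proof -
  have T: "convex_cone T" unfolding D(2) by (rule convex_cone_convex_cone_hull)
  then have "0 \<in> snd ` T" using convex_cone_contains_0[OF T] by force
  then have "cone_inv_norm NX T 0 \<le> inv_norm NX NY (cone_map T)"
    unfolding inv_norm_cone_map
    by (intro cSUP_upper cone_inv_norm_bdd_above[OF NX NY D]) (auto simp: is_norm_0[OF NY])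
  then show ?thesis by (simp add: cone_inv_norm_0[OF NX T])
qed

text \<open>When the image is a subspace it contains differences, so sublinearity makes the minimal
  preimage norm Lipschitz. It therefore attains its maximum on the compact unit ball of the
  image.\<close>

lemma inv_norm_attained:
  fixes D :: "('a::euclidean_space \<times> 'b::euclidean_space) set"
  assumes NX: "is_norm NX" and NY: "is_norm NY" and D: "finite D" "T = convex_cone hull D"
    and sub: "subspace (snd ` T)"
  obtains y where "y \<in> snd ` T" "NY y \<le> 1" "cone_inv_norm NX T y = inv_norm NX NY (cone_map T)"
proof -
  define m where "m = cone_inv_norm NX T"
  define H where "H = inv_norm NX NY (cone_map T)"
  have T: "convex_cone T" unfolding D(2) by (rule convex_cone_convex_cone_hull)
  have le: "m y - m z \<le> H * NY (y - z)" if yz: "y \<in> snd ` T" "z \<in> snd ` T" for y z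
  proof -
    have "y - z \<in> snd ` T" using yz by (rule subspace_diff[OF sub])
    then have "m ((y - z) + z) \<le> m (y - z) + m z" "m (y - z) \<le> H * NY (y - z)"
      unfolding m_def H_def using yz
      by (intro cone_inv_norm_add[OF NX T] cone_inv_norm_le_inv_norm[OF NX NY D]; simp)+
    then show ?thesis by simp
  qed
  have lip: "norm (m y - m z) \<le> H * NY (y - z)" if "y \<in> snd ` T" "z \<in> snd ` T" for y z
    using le[OF that] le[OF that(2,1)] by (simp add: abs_le_iff is_norm_minus_commute[OF NY, of z y])
  define S where "S = snd ` T \<inter> {y. NY (0 - y) \<le> 1}"
  have "continuous_on (snd ` T) m"
    unfolding continuous_on_def
  proof
    fix z assume z: "z \<in> snd ` T"
    have "continuous_on UNIV (\<lambda>y. H * NY (y - z))"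
      by (intro continuous_intros continuous_on_compose2[OF continuous_on_is_norm[OF NY, of UNIV]]) auto
    then have "((\<lambda>y. H * NY (y - z)) \<longlongrightarrow> H * NY (z - z)) (at z within snd ` T)"
      by (meson UNIV_I continuous_on_def continuous_on_subset subset_UNIV z)
    then have "((\<lambda>y. H * NY (y - z)) \<longlongrightarrow> 0) (at z within snd ` T)"
      by (simp add: is_norm_0[OF NY])
    moreover have "\<forall>\<^sub>F y in at z within snd ` T. norm (m y - m z) \<le> H * NY (y - z)"
      using lip z by (auto simp: eventually_at_filter)
    ultimately have "((\<lambda>y. m y - m z) \<longlongrightarrow> 0) (at z within snd ` T)"
      by (rule Lim_null_comparison[rotated])
    then show "(m \<longlongrightarrow> m z) (at z within snd ` T)"
      by (rule Lim_null[THEN iffD2])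
  qed
  then have "continuous_on S m" by (rule continuous_on_subset) (auto simp: S_def)
  moreover have "compact S"
    unfolding S_def by (intro compact_Int_is_norm_ball NY closed_subspace sub)
  moreover have "S \<noteq> {}"
    using subspace_0[OF sub] by (auto simp: S_def is_norm_0[OF NY])
  ultimately obtain y where y: "y \<in> S" "\<And>z. z \<in> S \<Longrightarrow> m z \<le> m y"
    using continuous_attains_sup by metis
  have S_eq: "S = {y \<in> snd ` T. NY y \<le> 1}"
    by (auto simp: S_def is_norm_minus[OF NY])
  have "H = m y"
    unfolding H_def inv_norm_cone_map S_eq[symmetric] m_def[symmetric]
  proof (rule antisym)
    show "(SUP y\<in>S. m y) \<le> m y"
      using y by (intro cSUP_least) auto
    show "m y \<le> (SUP y\<in>S. m y)"
      using y(1) cone_inv_norm_bdd_above[OF NX NY D]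
      by (intro cSUP_upper) (auto simp: S_eq m_def)
  qed
  then show thesis
    using that[of y] y(1) by (simp add: S_eq m_def H_def)
qed

subsection \<open>The Hoffman constant\<close>

lemma surj_cone_generated:
  fixes G :: "('a::euclidean_space \<times> 'b::euclidean_space) set"
  assumes "polyhedron G" "T \<in> surj_cones G"
  obtains z D where "z \<in> G" "T = tangent_cone G z" "finite D" "T = convex_cone hull D"
    "subspace (snd ` T)"
proof -
  obtain z where z: "z \<in> G" "T = tangent_cone G z" "subspace (snd ` T)"
    using assms(2)
    unfolding surj_cones_def tangent_cones_def relatively_surjective_def sv_Im_cone_map by blast
  obtain D where "finite D" "tangent_cone G z = convex_cone hull D"
    using tangent_cone_finitely_generated[OF assms(1) z(1)] by metis
  with z show thesis by (intro that[of z D]) simp_all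
qed

lemma finite_surj_cones:
  fixes G :: "('a::euclidean_space \<times> 'b::euclidean_space) set"
  shows "polyhedron G \<Longrightarrow> finite (surj_cones G)"
  unfolding surj_cones_def by (intro finite_Collect_conjI disjI1) (simp add: finite_tangent_cones)

text \<open>The zero functional is nonpositive on every tangent cone, so
  \<open>polar_surj_cone\<close> applies at any point of \<open>G\<close>.\<close>

lemma surj_cones_nonempty:
  fixes G :: "('a::euclidean_space \<times> 'b::euclidean_space) set"
  assumes "polyhedron G" "G \<noteq> {}"
  shows "surj_cones G \<noteq> {}"
proof -
  obtain z where "z \<in> G" using assms by auto
  moreover have "(0, 0) \<bullet> d \<le> 0" for d :: "'a \<times> 'b"
    by (cases d) simp
  ultimately obtain T where "T \<in> surj_cones G"
    using polar_surj_cone[OF assms(1)] by blast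
  then show ?thesis by blast
qed

section \<open>The bound and its tightness for a fixed mapping\<close>

context
  fixes \<Phi> :: "'a::euclidean_space \<Rightarrow> 'b::euclidean_space set"
    and NX :: "'a \<Rightarrow> real" and NY :: "'b \<Rightarrow> real"
  assumes NX: "is_norm NX" and NY: "is_norm NY" and \<Phi>: "polyhedral_map \<Phi>"
begin

lemma polyhedron_sv_graph: "polyhedron (sv_graph \<Phi>)"
  using \<Phi> by (simp add: polyhedral_map_def)

lemma mem_sv_graph: "(x, y) \<in> sv_graph \<Phi> \<longleftrightarrow> y \<in> \<Phi> x"
  by (simp add: sv_graph_def)

lemma inv_norm_le_hoffman_const:
  "T \<in> surj_cones (sv_graph \<Phi>) \<Longrightarrow> inv_norm NX NY (cone_map T) \<le> hoffman_const NX NY \<Phi>"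
  unfolding hoffman_const_def
  using finite_surj_cones[OF polyhedron_sv_graph] by (intro Max_ge) auto

lemma hoffman_const_attained:
  obtains T where "T \<in> surj_cones (sv_graph \<Phi>)" "hoffman_const NX NY \<Phi> = inv_norm NX NY (cone_map T)"
proof -
  have "surj_cones (sv_graph \<Phi>) \<noteq> {}"
    using \<Phi> by (intro surj_cones_nonempty) (auto simp: polyhedral_map_def)
  then have "hoffman_const NX NY \<Phi> \<in> (\<lambda>T. inv_norm NX NY (cone_map T)) ` surj_cones (sv_graph \<Phi>)"
    unfolding hoffman_const_def
    using finite_surj_cones[OF polyhedron_sv_graph] by (intro Max_in) auto
  then show thesis using that by auto
qed

lemma hoffman_const_nonneg: "0 \<le> hoffman_const NX NY \<Phi>"
proof -
  obtain T where T: "T \<in> surj_cones (sv_graph \<Phi>)" "hoffman_const NX NY \<Phi> = inv_norm NX NY (cone_map T)"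
    by (rule hoffman_const_attained)
  obtain D where "finite D" "T = convex_cone hull D"
    using surj_cone_generated[OF polyhedron_sv_graph T(1)] by metis
  then show ?thesis unfolding T(2) by (rule inv_norm_nonneg[OF NX NY])
qed

lemma convex_sv_inv: "convex (sv_inv \<Phi> b)"
proof (rule convexI)
  fix x y and s t :: real
  assume "x \<in> sv_inv \<Phi> b" "y \<in> sv_inv \<Phi> b" and st: "0 \<le> s" "0 \<le> t" "s + t = 1"
  then have "s *\<^sub>R (x, b) + t *\<^sub>R (y, b) \<in> sv_graph \<Phi>"
    by (intro convexD[OF polyhedron_imp_convex[OF polyhedron_sv_graph]])
       (auto simp: sv_inv_def mem_sv_graph)
  then show "s *\<^sub>R x + t *\<^sub>R y \<in> sv_inv \<Phi> b"
    using st by (simp add: sv_inv_def mem_sv_graph flip: scaleR_add_left)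
qed

lemma closed_sv_inv: "closed (sv_inv \<Phi> b)"
proof -
  have "sv_inv \<Phi> b = (\<lambda>x. (x, b)) -` sv_graph \<Phi>"
    by (auto simp: sv_inv_def sv_graph_def)
  then show ?thesis
    using polyhedron_imp_closed[OF polyhedron_sv_graph]
    by (auto intro!: closed_vimage continuous_intros)
qed

text \<open>The estimate for one \<open>v\<close> at a time; passing to the infimum over
  \<open>v\<close> is left to \<open>hoffman_bound\<close>.\<close>

lemma norm_dist_sv_inv_le:
  assumes x\<^sub>0: "b \<in> \<Phi> x\<^sub>0" and v: "v \<in> \<Phi> u"
  shows "norm_dist NX u (sv_inv \<Phi> b) \<le> hoffman_const NX NY \<Phi> * NY (b - v)"
proof -
  have ne: "sv_inv \<Phi> b \<noteq> {}" using x\<^sub>0 by (auto simp: sv_inv_def)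
  obtain x where x: "x \<in> sv_inv \<Phi> b" and dist: "norm_dist NX u (sv_inv \<Phi> b) = NX (u - x)"
    and min: "\<And>y. y \<in> sv_inv \<Phi> b \<Longrightarrow> NX (u - x) \<le> NX (u - y)"
    using norm_dist_attained[OF NX closed_sv_inv ne, of u] by blast
  define r where "r = NX (u - x)"
  show ?thesis
  proof (cases "r = 0")
    case True
    then show ?thesis
      unfolding dist r_def[symmetric]
      using hoffman_const_nonneg is_norm_nonneg[OF NY] by simp
  next
    case False
    then have "r > 0" using is_norm_nonneg[OF NX, of "u - x"] by (simp add: r_def)
    moreover have "r \<le> NX (s - u)" if "s \<in> sv_inv \<Phi> b" for s
      using min[OF that] by (simp add: r_def is_norm_minus_commute[OF NX])
    ultimately obtain p where p: "\<And>h. p \<bullet> h \<le> NX h"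
      and sep: "\<And>s. s \<in> sv_inv \<Phi> b \<Longrightarrow> r \<le> p \<bullet> (s - u)"
      using separate_from_norm_ball[OF NX convex_sv_inv ne] by metis
    \<comment> \<open>The dual norm bound gives at most \<open>r\<close>, and separation at
      \<open>x\<close> itself gives at least \<open>r\<close>.\<close>
    have px: "p \<bullet> (x - u) = r"
      using p[of "x - u"] sep[OF x] by (simp add: r_def is_norm_minus_commute[OF NX, of u x])
    have xG: "(x, b) \<in> sv_graph \<Phi>" using x by (simp add: sv_inv_def mem_sv_graph)
    obtain D where D: "finite D" "tangent_cone (sv_graph \<Phi>) (x, b) = convex_cone hull D"
      using tangent_cone_finitely_generated[OF polyhedron_sv_graph xG] by metis
    \<comment> \<open>A direction with zero second component moves \<open>x\<close> within the
      preimage of \<open>b\<close>, along which the product with \<open>p\<close> cannot fall below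
      its value at \<open>x\<close>.\<close>
    have "(- p) \<bullet> w \<le> 0" if "(w, 0) \<in> convex_cone hull D" for w
    proof -
      obtain t where t: "t > 0" "(x, b) + t *\<^sub>R (w, 0) \<in> sv_graph \<Phi>"
        using \<open>(w, 0) \<in> convex_cone hull D\<close> unfolding D(2)[symmetric] tangent_cone_def by blast
      then have "r \<le> p \<bullet> (x + t *\<^sub>R w - u)"
        by (intro sep) (simp add: sv_inv_def mem_sv_graph)
      then have "0 \<le> t * (p \<bullet> w)"
        using px by (simp add: inner_diff_right inner_add_right)
      then show ?thesis using t(1) by (simp add: zero_le_mult_iff)
    qed
    then obtain q where q: "\<And>d. d \<in> tangent_cone (sv_graph \<Phi>) (x, b) \<Longrightarrow> (- p, q) \<bullet> d \<le> 0"
      using farkas_fixed_component[OF D(1), of "- p"] unfolding D(2) by metis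
    obtain T q' where T: "T \<in> surj_cones (sv_graph \<Phi>)" "tangent_cone (sv_graph \<Phi>) (x, b) \<subseteq> T"
      and q': "\<And>d. d \<in> T \<Longrightarrow> (- p, q') \<bullet> d \<le> 0"
      using polar_surj_cone[OF polyhedron_sv_graph xG q] by metis
    obtain E where E: "finite E" "T = convex_cone hull E" and sub: "subspace (snd ` T)"
      using surj_cone_generated[OF polyhedron_sv_graph T(1)] by metis
    have "(u, v) - (x, b) \<in> T"
      using diff_in_tangent_cone[of "(u, v)" "sv_graph \<Phi>" "(x, b)"] v T(2)
      by (auto simp: mem_sv_graph)
    then have uv: "(u - x, v - b) \<in> T" by simp
    then have "- (v - b) \<in> snd ` T"
      by (intro subspace_neg[OF sub]) force
    then have bv: "b - v \<in> snd ` T" by simp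
    have "r \<le> q' \<bullet> (b - v)"
      using q'[OF uv] px by (simp add: inner_diff_right)
    also have "q' \<bullet> (b - v) \<le> cone_inv_norm NX T (b - v)"
    proof (rule cone_inv_norm_greatest[OF bv])
      fix w assume "(w, b - v) \<in> T"
      from q'[OF this] p[of w] show "q' \<bullet> (b - v) \<le> NX w" by simp
    qed
    also have "\<dots> \<le> inv_norm NX NY (cone_map T) * NY (b - v)"
      by (rule cone_inv_norm_le_inv_norm[OF NX NY E bv])
    also have "\<dots> \<le> hoffman_const NX NY \<Phi> * NY (b - v)"
      using inv_norm_le_hoffman_const[OF T(1)] is_norm_nonneg[OF NY] by (rule mult_right_mono)
    finally show ?thesis by (simp add: dist r_def)
  qed
qed

lemma hoffman_bound:
  assumes "b \<in> sv_Im \<Phi>" "u \<in> sv_dom \<Phi>"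
  shows "norm_dist NX u (sv_inv \<Phi> b) \<le> hoffman_const NX NY \<Phi> * norm_dist NY b (\<Phi> u)"
proof -
  define H where "H = hoffman_const NX NY \<Phi>"
  obtain x\<^sub>0 where x\<^sub>0: "b \<in> \<Phi> x\<^sub>0" using assms(1) by (auto simp: sv_Im_def)
  have ne: "\<Phi> u \<noteq> {}" using assms(2) by (simp add: sv_dom_def)
  have le: "norm_dist NX u (sv_inv \<Phi> b) \<le> H * NY (b - v)" if "v \<in> \<Phi> u" for v
    using norm_dist_sv_inv_le[OF x\<^sub>0 that] by (simp add: H_def)
  show ?thesis
  \<comment> \<open>Passing to the infimum over \<open>v\<close> divides by \<open>H\<close>. If
    \<open>H = 0\<close>, any single \<open>v\<close> already gives the claim.\<close>
  proof (cases "H = 0")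
    case True
    then show ?thesis using le ne by (force simp flip: H_def)
  next
    case False
    then have "H > 0" using hoffman_const_nonneg by (simp add: H_def)
    then have "norm_dist NX u (sv_inv \<Phi> b) / H \<le> norm_dist NY b (\<Phi> u)"
      unfolding norm_dist_def[of NY] using ne le
      by (intro cINF_greatest) (auto simp: field_simps)
    then show ?thesis
      using \<open>H > 0\<close> by (simp add: field_simps flip: H_def)
  qed
qed

text \<open>The preimage of \<open>b\<close> has distance at least \<open>t * H\<close> from
  \<open>u\<close>, while \<open>b\<close> has distance at most \<open>t\<close> from \<Phi>(u).
  With \<open>hoffman_bound\<close> the chain closes up and both sides equal
  \<open>t * H\<close>.\<close>

lemma hoffman_bound_tight:
  assumes pos: "hoffman_const NX NY \<Phi> > 0"
  obtains b u where "b \<in> sv_Im \<Phi>" "u \<in> sv_dom \<Phi>"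
    "norm_dist NX u (sv_inv \<Phi> b) = hoffman_const NX NY \<Phi> * norm_dist NY b (\<Phi> u)"
    "norm_dist NX u (sv_inv \<Phi> b) > 0"
proof -
  define H where "H = hoffman_const NX NY \<Phi>"
  obtain T where T: "T \<in> surj_cones (sv_graph \<Phi>)" and HT: "H = inv_norm NX NY (cone_map T)"
    unfolding H_def by (rule hoffman_const_attained)
  obtain z D where z: "z \<in> sv_graph \<Phi>" "T = tangent_cone (sv_graph \<Phi>) z"
    and D: "finite D" "T = convex_cone hull D" and sub: "subspace (snd ` T)"
    using surj_cone_generated[OF polyhedron_sv_graph T] by metis
  obtain y where y: "y \<in> snd ` T" "NY y \<le> 1" "cone_inv_norm NX T y = H"
    unfolding HT using inv_norm_attained[OF NX NY D sub] by metis
  obtain w where w: "(w, y) \<in> T" using y(1) by auto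
  obtain u v where uv: "z = (u, v)" by (cases z)
  obtain t where t: "t > 0" "(u, v) + t *\<^sub>R (w, y) \<in> sv_graph \<Phi>"
    using w unfolding z(2) uv tangent_cone_def by blast
  define b where "b = v + t *\<^sub>R y"
  have b: "b \<in> \<Phi> (u + t *\<^sub>R w)"
    using t(2) by (simp add: b_def mem_sv_graph)
  then have bI: "b \<in> sv_Im \<Phi>" by (auto simp: sv_Im_def)
  have v: "v \<in> \<Phi> u" using z(1) by (simp add: uv mem_sv_graph)
  then have uD: "u \<in> sv_dom \<Phi>" by (auto simp: sv_dom_def)
  have T_cone: "convex_cone T" unfolding D(2) by (rule convex_cone_convex_cone_hull)
  \<comment> \<open>Every preimage \<open>x\<close> of \<open>b\<close> yields
    \<open>(x - u, t *\<^sub>R y)\<close> in \<open>T\<close>, so homogeneity bounds its distance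
    from \<open>u\<close> below by \<open>t\<close> times the inverse norm attained at
    \<open>y\<close>.\<close>
  have "t * H \<le> norm_dist NX u (sv_inv \<Phi> b)"
    unfolding norm_dist_def
  proof (rule cINF_greatest)
    show "sv_inv \<Phi> b \<noteq> {}" using b by (auto simp: sv_inv_def)
    fix x assume "x \<in> sv_inv \<Phi> b"
    then have "(x, b) - (u, v) \<in> T"
      unfolding z(2) uv by (intro diff_in_tangent_cone) (simp add: sv_inv_def mem_sv_graph)
    then have "(x - u, t *\<^sub>R y) \<in> T" by (simp add: b_def)
    then have "cone_inv_norm NX T (t *\<^sub>R y) \<le> NX (x - u)"
      by (rule cone_inv_norm_le[OF NX])
    then show "t * H \<le> NX (u - x)"
      using cone_inv_norm_scaleR[OF NX T_cone y(1) t(1)]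
      by (simp add: y(3) is_norm_minus_commute[OF NX, of u x])
  qed
  moreover have "norm_dist NY b (\<Phi> u) \<le> t"
  proof -
    have "norm_dist NY b (\<Phi> u) \<le> t * NY y"
      using norm_dist_le[OF NY v, of b] t(1) by (simp add: b_def is_norm_scaleR[OF NY])
    also have "\<dots> \<le> t * 1" using t(1) y(2) by (intro mult_left_mono) auto
    finally show ?thesis by simp
  qed
  then have "H * norm_dist NY b (\<Phi> u) \<le> t * H"
    using pos by (simp add: H_def mult.commute[of t])
  moreover have "norm_dist NX u (sv_inv \<Phi> b) \<le> H * norm_dist NY b (\<Phi> u)"
    unfolding H_def by (rule hoffman_bound[OF bI uD])
  moreover have "t * H > 0" using t(1) pos by (simp add: H_def)
  ultimately show thesis
    using that[OF bI uD] by (simp add: H_def)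
qed

end

theorem theorem1:
  fixes \<Phi> :: "real ^ 'n \<Rightarrow> (real ^ 'm) set"
    and NX :: "real ^ 'n \<Rightarrow> real"
    and NY :: "real ^ 'm \<Rightarrow> real"
  assumes "is_norm NX" and "is_norm NY" and "polyhedral_map \<Phi>"
  shows "(\<forall>b\<in>sv_Im \<Phi>. \<forall>u\<in>sv_dom \<Phi>.
            norm_dist NX u (sv_inv \<Phi> b) \<le> hoffman_const NX NY \<Phi> * norm_dist NY b (\<Phi> u)) \<and>
         (hoffman_const NX NY \<Phi> > 0 \<longrightarrow>
            (\<exists>b\<in>sv_Im \<Phi>. \<exists>u\<in>sv_dom \<Phi>.
               norm_dist NX u (sv_inv \<Phi> b) = hoffman_const NX NY \<Phi> * norm_dist NY b (\<Phi> u) \<and>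
               hoffman_const NX NY \<Phi> * norm_dist NY b (\<Phi> u) > 0))"
proof (intro conjI ballI impI)
  fix b u assume "b \<in> sv_Im \<Phi>" "u \<in> sv_dom \<Phi>"
  then show "norm_dist NX u (sv_inv \<Phi> b) \<le> hoffman_const NX NY \<Phi> * norm_dist NY b (\<Phi> u)"
    by (rule hoffman_bound[OF assms])
next
  assume "hoffman_const NX NY \<Phi> > 0"
  then obtain b u where "b \<in> sv_Im \<Phi>" "u \<in> sv_dom \<Phi>"
    "norm_dist NX u (sv_inv \<Phi> b) = hoffman_const NX NY \<Phi> * norm_dist NY b (\<Phi> u)"
    "norm_dist NX u (sv_inv \<Phi> b) > 0"
    by (rule hoffman_bound_tight[OF assms])
  then show "\<exists>b\<in>sv_Im \<Phi>. \<exists>u\<in>sv_dom \<Phi>.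
      norm_dist NX u (sv_inv \<Phi> b) = hoffman_const NX NY \<Phi> * norm_dist NY b (\<Phi> u) \<and>
      hoffman_const NX NY \<Phi> * norm_dist NY b (\<Phi> u) > 0"
    by (intro bexI conjI) auto
qed

end
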